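(* Let $r$ be a positive integer and $N(u)=(u-1)^r$, and write $\zeta_{\mathbb{G}_{\rm m}^{\otimes r}}=\zeta_N$. Then: (1) $\zeta_{\mathbb{G}_{\rm m}^{\otimes r}}(s)=\Gamma_{-r}(s-r)$; (2) for $\operatorname{Re}(s)>r$, $\zeta_{\mathbb{G}_{\rm m}^{\otimes r}}(s)=\exp\left(\int_1^\infty(u-1)^r u^{-s-1}(\log u)^{-1}\,du\right)$.
   Context: For $N:(1,\infty)\to\mathbb{C}$, $Z_N(w;s)=\frac{1}{\Gamma(w)}\int_1^\infty N(u)u^{-s-1}(\log u)^{w-1}du$, defined where convergent and extended to all $w$ by analytic continuation in $w$; $\zeta_N(s)=\exp\left(\left.\frac{\partial}{\partial w}Z_N(w;s)\right|_{w=0}\right)$. For the negative integer $-r$, $\zeta_{-r}(w;x)=\sum_{n=0}^{r}(-1)^n\binom{r}{n}(n+x)^{-w}$ (principal branch), and $\Gamma_{-r}(x)=\exp\left(\left.\frac{\partial}{\partial w}\zeta_{-r}(w;x)\right|_{w=0}\right)$. *)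

theory Defs
  imports "HOL-Complex_Analysis.Complex_Analysis"
begin

definition Z_integrand :: "(real \<Rightarrow> complex) \<Rightarrow> complex \<Rightarrow> complex \<Rightarrow> real \<Rightarrow> complex" where
  "Z_integrand N s w u = N u * of_real u powr (- s - 1) * of_real (ln u) powr (w - 1)"

definition Z_conv :: "(real \<Rightarrow> complex) \<Rightarrow> complex \<Rightarrow> complex set" where
  "Z_conv N s = {w. set_integrable lborel {1<..} (Z_integrand N s w)}"

text \<open>
  \<open>F\<close> is the analytic continuation of \<open>w \<mapsto> Z\<^sub>N(w; s)\<close> to the whole plane. Poles are permitted, as
  they occur for general \<open>N\<close>. The function is determined by \<open>N\<close> and \<open>s\<close>: a nicely meromorphic
  function takes the value 0 at its poles and its limit elsewhere, and the set of convergence is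
  required to have interior points. The factor \<open>rGamma w\<close> is \<open>1 / Gamma w\<close>, with the value 0 at
  the poles of \<open>Gamma\<close>.
\<close>
definition is_Z :: "(real \<Rightarrow> complex) \<Rightarrow> complex \<Rightarrow> (complex \<Rightarrow> complex) \<Rightarrow> bool" where
  "is_Z N s F \<longleftrightarrow>
     F nicely_meromorphic_on UNIV \<and> interior (Z_conv N s) \<noteq> {} \<and>
     (\<forall>w\<in>Z_conv N s. F w = rGamma w * (LINT u:{1<..}|lborel. Z_integrand N s w u))"

definition Z_fun :: "(real \<Rightarrow> complex) \<Rightarrow> complex \<Rightarrow> complex \<Rightarrow> complex" where
  "Z_fun N w s = (THE F. is_Z N s F) w"

definition zeta_dom :: "(real \<Rightarrow> complex) \<Rightarrow> complex set" where
  "zeta_dom N = {s. \<exists>F. is_Z N s F \<and> F analytic_on {0}}"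

definition zeta_direct :: "(real \<Rightarrow> complex) \<Rightarrow> complex \<Rightarrow> complex" where
  "zeta_direct N s = exp (deriv (\<lambda>w. Z_fun N w s) 0)"

definition is_zeta_continuation :: "(real \<Rightarrow> complex) \<Rightarrow> (complex \<Rightarrow> complex) \<Rightarrow> bool" where
  "is_zeta_continuation N G \<longleftrightarrow>
     G nicely_meromorphic_on UNIV \<and> interior (zeta_dom N) \<noteq> {} \<and>
     (\<forall>s\<in>interior (zeta_dom N). G s = zeta_direct N s)"

text \<open>
  Where the defining formula makes sense it is used as it stands. At the remaining \<open>s\<close> (for
  \<open>N u = (u - 1) ^ r\<close>, those with \<open>Re s < r\<close>, where the integral diverges for every \<open>w\<close>) the value
  is that of the meromorphic continuation in \<open>s\<close>.
\<close>
definition zeta_N :: "(real \<Rightarrow> complex) \<Rightarrow> complex \<Rightarrow> complex" where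
  "zeta_N N s =
     (if s \<in> zeta_dom N then zeta_direct N s else (THE G. is_zeta_continuation N G) s)"

definition zeta_Gm :: "nat \<Rightarrow> complex \<Rightarrow> complex" where
  "zeta_Gm r = zeta_N (\<lambda>u. of_real ((u - 1) ^ r))"

text \<open>
  The functions \<open>\<zeta>\<^bsub>-r\<^esub>(w; x)\<close> and \<open>\<Gamma>\<^bsub>-r\<^esub>(x)\<close>, with meaning only for
  \<open>x \<notin> {0, -1, \<dots>, -r}\<close>; note that \<open>0 powr w = 0\<close> by convention.
\<close>
definition zeta_neg :: "nat \<Rightarrow> complex \<Rightarrow> complex \<Rightarrow> complex" where
  "zeta_neg r w x = (\<Sum>n=0..r. (-1) ^ n * of_nat (r choose n) * (of_nat n + x) powr (- w))"

definition Gamma_neg :: "nat \<Rightarrow> complex \<Rightarrow> complex" where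
  "Gamma_neg r x = exp (deriv (\<lambda>w. zeta_neg r w x) 0)"

end

theory Submission
  imports Defs
begin

text \<open>
  Substituting \<open>u = exp t\<close> and putting \<open>x = s - r\<close> turns the integral defining \<open>Z\<^sub>N(w; s)\<close> into
  \<open>\<integral> (1 - exp (-t))\<^sup>r exp (-x t) t\<^bsup>w - 1\<^esup> dt\<close> over \<open>t > 0\<close>. For \<open>Re x > 0\<close> and \<open>Re w > 0\<close> the binomial
  theorem and Euler's integral give \<open>\<Gamma>(w) \<zeta>\<^bsub>-r\<^esub>(w; x)\<close>. The factor \<open>(1 - exp (-t))\<^sup>r\<close> makes the integral
  holomorphic for \<open>Re w > -r\<close>, so the identity extends to a neighbourhood of \<open>w = 0\<close>, where \<open>1/\<Gamma>\<close> has
  a simple zero with derivative 1; hence the \<open>w\<close>-derivative at 0 is the integral at \<open>w = 0\<close>. The integral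
  diverges for all \<open>w\<close> if \<open>Re s < r\<close>; there both sides are continued in \<open>s\<close>, since \<open>\<Gamma>\<^bsub>-r\<^esub>(x)\<close> is the
  rational function \<open>\<Prod>\<^sub>n (n + x)\<^bsup>e(n)\<^esup>\<close> with \<open>e(n) = -(-1)\<^sup>n (r choose n)\<close>.
\<close>

section \<open>Identity theorem and holomorphic parameter integrals\<close>

text \<open>This is what makes the two definite descriptions behind \<open>zeta_N\<close> well
  defined. The difference vanishes on an open set, hence off a discrete set by the identity theorem;
  the normalisation of values then settles the remaining points.\<close>

lemma nicely_meromorphic_eqI:
  assumes F: "F nicely_meromorphic_on UNIV" and G: "G nicely_meromorphic_on UNIV"
    and S: "open S" "S \<noteq> {}" and eq: "\<And>z. z \<in> S \<Longrightarrow> F z = G z"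
  shows "F = G"
proof
  fix z
  define H where "H = (\<lambda>z. F z - G z)"
  have mero: "H meromorphic_on UNIV"
    using F G unfolding H_def nicely_meromorphic_on_def by (intro meromorphic_intros) auto
  have ev: "eventually (\<lambda>w. remove_sings H w = H w) (at z)" for z
    using mero by (intro eventually_remove_sings_eq_at meromorphic_on_isolated_singularity)
      (auto intro: meromorphic_on_subset)
  obtain z0 where z0: "z0 \<in> S" using S by blast
  have "eventually (\<lambda>w. w \<in> S) (at z0)" using S z0 by (intro eventually_at_in_open')
  with ev[of z0] have "eventually (\<lambda>w. remove_sings H w = 0) (at z0)"
    by eventually_elim (simp add: H_def eq)
  then have "frequently (\<lambda>w. remove_sings H w = 0) (at z0)"
    by (intro eventually_frequently) auto
  then have "remove_sings H w = 0" for w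
    by (rule frequently_eq_meromorphic_imp_constant[OF _ remove_sings_nicely_meromorphic[OF mero]]) auto
  with ev[of z] have FG: "eventually (\<lambda>w. F w = G w) (at z)"
    by (auto simp: H_def elim: eventually_mono)
  then have pole: "is_pole F z \<longleftrightarrow> is_pole G z" by (intro is_pole_cong) auto
  have lim: "F \<midarrow>z\<rightarrow> c \<longleftrightarrow> G \<midarrow>z\<rightarrow> c" for c using FG by (rule tendsto_cong)
  \<comment> \<open>Being a pole and having a given limit depend only on punctured neighbourhoods,
    and they fix the value at \<open>z\<close>: 0 at a pole, the limit otherwise.\<close>
  have "is_pole F z \<and> F z = 0 \<or> F \<midarrow>z\<rightarrow> F z" "is_pole G z \<and> G z = 0 \<or> G \<midarrow>z\<rightarrow> G z"
    using F G by (auto simp: nicely_meromorphic_on_def)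
  then show "F z = G z"
    using pole lim LIM_unique not_tendsto_and_filterlim_at_infinity at_neq_bot
    unfolding is_pole_def by metis
qed

text \<open>The majorant is only local in \<open>z\<close>, because the kernels treated below have
  no integrable majorant on a whole half-plane.\<close>

lemma holomorphic_on_integral:
  fixes f :: "complex \<Rightarrow> 'a \<Rightarrow> complex"
  assumes S: "open S" and hol: "\<And>t. t \<in> space M \<Longrightarrow> (\<lambda>z. f z t) holomorphic_on S"
    and meas: "\<And>z. z \<in> S \<Longrightarrow> f z \<in> borel_measurable M"
    and bound: "\<And>z. z \<in> S \<Longrightarrow> \<exists>e>0. \<exists>h. integrable M h \<and>
                  (\<forall>w\<in>S \<inter> ball z e. \<forall>t\<in>space M. norm (f w t) \<le> h t)"
  shows "(\<lambda>z. integral\<^sup>L M (f z)) holomorphic_on S"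
  unfolding holomorphic_on_open[OF S]
proof (intro ballI)
  fix z assume z: "z \<in> S"
  \<comment> \<open>Cauchy's inequality bounds the difference quotients by a multiple of \<open>h\<close>, which allows
    dominated convergence.\<close>
  obtain e0 h where e0: "e0 > 0" and h: "integrable M h"
    and fh0: "\<And>w t. w \<in> S \<inter> ball z e0 \<Longrightarrow> t \<in> space M \<Longrightarrow> norm (f w t) \<le> h t"
    using bound[OF z] by blast
  obtain e1 where e1: "e1 > 0" "ball z e1 \<subseteq> S" using S z openE by blast
  define e where "e = min e0 e1"
  have e: "e > 0" "ball z e \<subseteq> S" using e0 e1 by (auto simp: e_def)
  have fh: "norm (f w t) \<le> h t" if "w \<in> ball z e" "t \<in> space M" for w t
    using that e fh0[of w t] by (auto simp: e_def)
  have holb: "(\<lambda>z. f z t) holomorphic_on ball z e" if "t \<in> space M" for t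
    using hol[OF that] e(2) holomorphic_on_subset by blast
  have int: "integrable M (f w)" if "w \<in> ball z e" for w
    using that e(2) by (intro Bochner_Integration.integrable_bound[OF h] meas AE_I2)
      (auto intro!: order_trans[OF fh[OF that]])
  have der: "norm (deriv (\<lambda>z. f z t) v) \<le> h t / (e/3)" 
    if t: "t \<in> space M" and v: "v \<in> ball z (e/2)" for t v
  proof -
    \<comment> \<open>The radii fit because 1/2 + 1/3 < 1.\<close>
    have sub: "cball v (e/3) \<subseteq> ball z e"
    proof
      fix y assume "y \<in> cball v (e/3)"
      then show "y \<in> ball z e" using v e(1) dist_triangle[of z y v] by auto
    qed
    have "norm ((deriv ^^ 1) (\<lambda>z. f z t) v) \<le> fact 1 * h t / (e/3) ^ 1"
    proof (rule Cauchy_inequality)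
      show "(\<lambda>z. f z t) holomorphic_on ball v (e/3)"
        using holb[OF t] sub ball_subset_cball holomorphic_on_subset by blast
      show "continuous_on (cball v (e/3)) (\<lambda>z. f z t)"
        using holb[OF t] sub holomorphic_on_imp_continuous_on holomorphic_on_subset by blast
      show "norm (f y t) \<le> h t" if "norm (v - y) = e/3" for y
        using sub that t by (intro fh) (auto simp: dist_norm)
    qed (use e in auto)
    then show ?thesis by simp
  qed
  have lip: "norm (f w t - f z t) \<le> h t / (e/3) * norm (w - z)"
    if t: "t \<in> space M" and w: "w \<in> ball z (e/2)" for t w
  proof (rule field_differentiable_bound[OF convex_ball])
    show "((\<lambda>z. f z t) has_field_derivative deriv (\<lambda>z. f z t) v) (at v within ball z (e/2))"
      if v: "v \<in> ball z (e/2)" for v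
      using v e(1) by (intro holomorphic_derivI[OF holb[OF t]]) auto
  qed (use der t w e in auto)
  let ?Q = "\<lambda>w t. (f w t - f z t) / (w - z)"
  have "((\<lambda>w. (integral\<^sup>L M (f w) - integral\<^sup>L M (f z)) / (w - z)) \<longlongrightarrow>
      integral\<^sup>L M (\<lambda>t. deriv (\<lambda>z. f z t) z)) (at z within ball z (e/2))"
    unfolding tendsto_at_iff_sequentially
  proof (intro allI impI)
    fix X assume X: "\<forall>i. X i \<in> ball z (e/2) - {z}" "X \<longlonglongrightarrow> z"
    have Xb: "X i \<in> ball z e" for i using X(1)[rule_format, of i] e(1) by auto
    have lim: "(\<lambda>i. ?Q (X i) t) \<longlonglongrightarrow> deriv (\<lambda>z. f z t) z" if "t \<in> space M" for t
    proof -
      have "((\<lambda>z. f z t) has_field_derivative deriv (\<lambda>z. f z t) z) (at z)"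
        using e by (intro holomorphic_derivI[OF holb[OF that]]) auto
      then have "((\<lambda>w. ?Q w t) \<longlongrightarrow> deriv (\<lambda>z. f z t) z) (at z)"
        by (simp add: has_field_derivative_iff)
      then show ?thesis using X unfolding tendsto_at_iff_sequentially by (auto simp: o_def)
    qed
    have measQ: "?Q (X i) \<in> borel_measurable M" for i
      using meas[OF z] subsetD[OF e(2) Xb, THEN meas, of i]
      by (intro borel_measurable_divide borel_measurable_diff borel_measurable_const)
    have "(\<lambda>i. integral\<^sup>L M (?Q (X i))) \<longlonglongrightarrow> integral\<^sup>L M (\<lambda>t. deriv (\<lambda>z. f z t) z)"
    proof (rule integral_dominated_convergence)
      show "(\<lambda>t. deriv (\<lambda>z. f z t) z) \<in> borel_measurable M"
        by (rule borel_measurable_LIMSEQ_metric[OF measQ lim])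
      show "integrable M (\<lambda>t. h t / (e/3))" using h by simp
      show "AE t in M. norm (?Q (X i) t) \<le> h t / (e/3)" for i
      proof (rule AE_I2)
        fix t assume t: "t \<in> space M"
        have "norm (X i - z) > 0" "X i \<in> ball z (e/2)" using X(1) by auto
        then show "norm (?Q (X i) t) \<le> h t / (e/3)"
          using lip[OF t, of "X i"] by (simp add: norm_divide pos_divide_le_eq)
      qed
    qed (use lim measQ in auto)
    moreover have eq: "integral\<^sup>L M (?Q (X i)) = (integral\<^sup>L M (f (X i)) - integral\<^sup>L M (f z)) / (X i - z)" for i
      using int[OF Xb[of i]] int[of z] e(1) by simp
    ultimately show "((\<lambda>w. (integral\<^sup>L M (f w) - integral\<^sup>L M (f z)) / (w - z)) \<circ> X)
        \<longlonglongrightarrow> integral\<^sup>L M (\<lambda>t. deriv (\<lambda>z. f z t) z)"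
      unfolding eq o_def by simp
  qed
  moreover have "at z within ball z (e/2) = at z" using e by (intro at_within_open) auto
  ultimately show "\<exists>f'. ((\<lambda>z. integral\<^sup>L M (f z)) has_field_derivative f') (at z)"
    by (auto simp: has_field_derivative_iff)
qed

section \<open>Substitution and Laplace transforms of powers\<close>

lemma set_borel_measurable_continuous_on:
  fixes f :: "real \<Rightarrow> complex"
  assumes "A \<in> sets borel" "continuous_on A f"
  shows "set_borel_measurable lborel A f"
  using borel_measurable_continuous_on_indicator[OF assms] unfolding set_borel_measurable_def by simp

lemma set_integrable_lebesgue_iff:
  fixes f :: "real \<Rightarrow> complex"
  assumes "set_borel_measurable lborel A f"
  shows "set_integrable lebesgue A f \<longleftrightarrow> set_integrable lborel A f"
  using assms unfolding set_integrable_def set_borel_measurable_def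
  by (intro integrable_completion) auto

text \<open>Change of variables is available for Lebesgue absolute integrability; continuity of
  \<open>f\<close> gives the Borel measurability that carries it over to
  \<open>lborel\<close>.\<close>

lemma set_integral_exp_substitution:
  fixes f :: "real \<Rightarrow> complex"
  assumes f: "continuous_on {1<..} f"
  shows "set_integrable lborel {1<..} f \<longleftrightarrow> set_integrable lborel {0<..} (\<lambda>t. exp t *\<^sub>R f (exp t))"
      (is "?P \<longleftrightarrow> ?Q")
    and "(LINT u:{1<..}|lborel. f u) = (LINT t:{0<..}|lborel. exp t *\<^sub>R f (exp t))"
proof -
  let ?g = "\<lambda>t. exp t *\<^sub>R f (exp t)"
  have img: "exp ` {0<..} = {1::real<..}"
  proof safe
    fix u :: real assume "1 < u"
    then show "u \<in> exp ` {0<..}" by (intro image_eqI[of _ _ "ln u"]) auto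
  qed auto
  have mf: "set_borel_measurable lborel {1<..} f"
    using f by (intro set_borel_measurable_continuous_on) auto
  have "continuous_on {0<..} ?g"
    by (intro continuous_intros continuous_on_compose2[OF f]) auto
  then have mg: "set_borel_measurable lborel {0<..} ?g"
    by (intro set_borel_measurable_continuous_on) auto
  have cv: "?g absolutely_integrable_on {0<..} \<and> integral {0<..} ?g = b
          \<longleftrightarrow> f absolutely_integrable_on {1<..} \<and> integral {1<..} f = b" for b
    using has_absolute_integral_change_of_variables_real[of "{0<..}" exp exp f b]
    by (simp add: img)
      (metis (mono_tags, lifting) DERIV_exp UNIV_I has_field_derivative_at_within inj_onI exp_inj_iff)
  show iff: "?P \<longleftrightarrow> ?Q"
    using cv set_integrable_lebesgue_iff[OF mf] set_integrable_lebesgue_iff[OF mg] by blast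
  show "(LINT u:{1<..}|lborel. f u) = (LINT t:{0<..}|lborel. ?g t)"
  proof (cases ?P)
    case True
    then show ?thesis
      using cv iff set_integrable_lebesgue_iff[OF mf] set_borel_integral_eq_integral(2)[of "{1<..}" f]
        set_borel_integral_eq_integral(2)[of "{0<..}" ?g] by metis
  next
    \<comment> \<open>Neither side is integrable, so both integrals are 0 by convention.\<close>
    case False
    with iff show ?thesis
      unfolding set_integrable_def set_lebesgue_integral_def by (simp add: not_integrable_integral_eq)
  qed
qed

text \<open>The majorant for the domination arguments; it is the norm of the integrand in Euler's
  integral for \<open>Gamma\<close>.\<close>

lemma set_integrable_powr_exp:
  fixes a b :: real
  assumes "a > 0" "b > 0"
  shows "set_integrable lborel {0<..} (\<lambda>t. t powr (a - 1) * exp (- (b * t)))"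
proof -
  let ?f = "\<lambda>t. complex_of_real t powr (of_real a - 1) / of_real (exp (b * t))"
  have "continuous_on {0<..} ?f" by (intro continuous_intros) auto
  then have "set_integrable lborel {0<..} ?f"
    using absolutely_integrable_Gamma_integral[of "of_real a" b] assms
    by (subst set_integrable_lebesgue_iff[symmetric]) (auto intro: set_borel_measurable_continuous_on)
  then have "set_integrable lborel {0<..} (\<lambda>t. norm (?f t))" by (rule set_integrable_norm)
  then show ?thesis
    by (rule set_integrable_cong[THEN iffD1, rotated -1])
      (auto simp: norm_divide norm_powr_real_powr exp_minus field_simps)
qed

lemma set_integrable_continuous_bound:
  fixes f :: "real \<Rightarrow> complex"
  assumes A: "A \<in> sets borel" and g: "set_integrable lborel A g" and f: "continuous_on A f"
    and le: "\<And>t. t \<in> A \<Longrightarrow> norm (f t) \<le> g t"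
  shows "set_integrable lborel A f"
  using set_borel_measurable_continuous_on[OF A f]
  by (rule set_integrable_bound[OF g _ AE_I2]) (use le in fastforce)

lemma holomorphic_on_set_integral:
  fixes f :: "complex \<Rightarrow> real \<Rightarrow> complex"
  assumes A: "A \<in> sets borel" and S: "open S"
    and hol: "\<And>t. t \<in> A \<Longrightarrow> (\<lambda>z. f z t) holomorphic_on S"
    and cont: "\<And>z. z \<in> S \<Longrightarrow> continuous_on A (f z)"
    and bound: "\<And>z. z \<in> S \<Longrightarrow> \<exists>e>0. \<exists>h. set_integrable lborel A h \<and>
                  (\<forall>w\<in>S \<inter> ball z e. \<forall>t\<in>A. norm (f w t) \<le> h t)"
  shows "(\<lambda>z. LINT t:A|lborel. f z t) holomorphic_on S"
  unfolding set_lebesgue_integral_def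
proof (rule holomorphic_on_integral[OF S])
  show "(\<lambda>z. indicat_real A t *\<^sub>R f z t) holomorphic_on S" for t
    using hol[of t] by (cases "t \<in> A") auto
  show "(\<lambda>t. indicat_real A t *\<^sub>R f z t) \<in> borel_measurable lborel" if "z \<in> S" for z
    using set_borel_measurable_continuous_on[OF A cont[OF that]] by (simp add: set_borel_measurable_def)
  fix z assume "z \<in> S"
  then obtain e h where "e > 0" "set_integrable lborel A h"
    and "\<forall>w\<in>S \<inter> ball z e. \<forall>t\<in>A. norm (f w t) \<le> h t" using bound by blast
  then show "\<exists>e>0. \<exists>h. integrable lborel h \<and> (\<forall>w\<in>S \<inter> ball z e. \<forall>t\<in>space lborel.
      norm (indicat_real A t *\<^sub>R f w t) \<le> h t)"
    unfolding set_integrable_def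
    by (intro exI[of _ e] conjI exI[of _ "\<lambda>t. indicat_real A t *\<^sub>R h t"])
       (auto simp: indicator_def)
qed

section \<open>Laplace transforms of complex powers\<close>

lemma Laplace_powr_integrable:
  fixes w x :: complex
  assumes "Re w > 0" "Re x > 0"
  shows "set_integrable lborel {0<..} (\<lambda>t. exp (- x * of_real t) * of_real t powr (w - 1))"
proof (rule set_integrable_continuous_bound[OF _ set_integrable_powr_exp[OF assms]])
  show "continuous_on {0<..} (\<lambda>t. exp (- x * complex_of_real t) * complex_of_real t powr (w - 1))"
    by (intro continuous_intros) auto
qed (auto simp: norm_mult norm_powr_real_powr)

text \<open>Scaling \<open>t\<close> by \<open>x\<close> in Euler's integral: the Jacobian
  \<open>x\<close> and the factor \<open>x powr (w - 1)\<close> combine to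
  \<open>x powr w\<close>.\<close>

lemma Laplace_powr_real:
  assumes w: "Re w > 0" and x: "x > 0"
  shows "(LINT t:{0<..}|lborel. exp (- of_real x * of_real t) * of_real t powr (w - 1)) =
    Gamma w * of_real x powr (- w)"
proof -
  let ?f = "\<lambda>t. exp (- 1 * of_real t) * complex_of_real t powr (w - 1)"
  have "set_integrable lborel {0<..} ?f" using w by (intro Laplace_powr_integrable) auto
  from set_borel_integral_eq_integral(2)[OF this]
  have "(LINT t:{0<..}|lborel. ?f t) = Gamma w"
    using Gamma_integral_complex'[OF w]
    by (simp add: has_integral_iff exp_minus field_simps flip: exp_of_real)
  then have "Gamma w = x *\<^sub>R (LINT t|lborel. indicat_real {0<..} (0 + x * t) *\<^sub>R ?f (0 + x * t))"
    unfolding set_lebesgue_integral_def using x by (subst (asm) lborel_integral_real_affine[of x _ 0]) auto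
  also have "\<dots> = of_real x * (LINT t:{0<..}|lborel. of_real x powr (w - 1) *
      (exp (- of_real x * of_real t) * of_real t powr (w - 1)))"
    unfolding set_lebesgue_integral_def scaleR_conv_of_real[of x]
    using x by (intro arg_cong2[of _ _ _ _ "(*)"] Bochner_Integration.integral_cong refl)
      (auto simp: indicator_def zero_less_mult_iff powr_times_real)
  also have "\<dots> = of_real x powr w * (LINT t:{0<..}|lborel. 
      (exp (- of_real x * of_real t) * of_real t powr (w - 1)))"
    unfolding set_integral_mult_right using x by (simp add: powr_diff)
  finally show ?thesis using x by (simp add: powr_minus field_simps)
qed

text \<open>The identity extends from real to complex \<open>x\<close> by analytic continuation in \<open>x\<close>.\<close>
lemma Laplace_powr:
  fixes w x :: complex
  assumes w: "Re w > 0" and x: "Re x > 0"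
  shows "(LINT t:{0<..}|lborel. exp (- x * of_real t) * of_real t powr (w - 1)) = Gamma w * x powr (- w)"
proof -
  let ?f = "\<lambda>x t. exp (- x * of_real t) * complex_of_real t powr (w - 1)"
  let ?S = "{x::complex. Re x > 0}"
  have "(LINT t:{0<..}|lborel. ?f x t) - Gamma w * x powr (- w) = 0"
  proof (rule analytic_continuation[of "\<lambda>x. (LINT t:{0<..}|lborel. ?f x t) - Gamma w * x powr (- w)"
        ?S "complex_of_real ` {0<..}" 1])
    have "(\<lambda>x. LINT t:{0<..}|lborel. ?f x t) holomorphic_on ?S"
    proof (rule holomorphic_on_set_integral)
      fix z assume "z \<in> ?S"
      then have z: "Re z > 0" by simp
      \<comment> \<open>On the disc of radius \<open>Re z / 2\<close> about \<open>z\<close> the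
        decay rate stays above \<open>Re z / 2\<close>.\<close>
      have "norm (?f y t) \<le> t powr (Re w - 1) * exp (- (Re z / 2 * t))" 
        if "dist z y < Re z / 2" "t > 0" for y t
      proof -
        have "Re z - Re y \<le> dist z y" using complex_Re_le_cmod[of "z - y"] by (simp add: dist_norm)
        then have "Re z / 2 * t \<le> Re y * t" using that by (intro mult_right_mono) auto
        then show ?thesis using that by (simp add: norm_mult norm_powr_real_powr)
      qed
      with z show "\<exists>e>0. \<exists>h. set_integrable lborel {0<..} h \<and>
                  (\<forall>y\<in>?S \<inter> ball z e. \<forall>t\<in>{0<..}. norm (?f y t) \<le> h t)"
        using set_integrable_powr_exp[OF w, of "Re z / 2"]
        by (intro exI[of _ "Re z / 2"] conjI exI[of _ "\<lambda>t. t powr (Re w - 1) * exp (- (Re z / 2 * t))"]) auto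
    qed (auto intro!: continuous_intros holomorphic_intros simp: open_halfspace_Re_gt)
    moreover have "(\<lambda>x. Gamma w * x powr (- w)) holomorphic_on ?S"
      by (intro holomorphic_intros) (auto simp: complex_nonpos_Reals_iff)
    ultimately show "(\<lambda>x. (LINT t:{0<..}|lborel. ?f x t) - Gamma w * x powr (- w)) holomorphic_on ?S"
      by (rule holomorphic_on_diff)
    show "1 islimpt complex_of_real ` {0<..}"
    proof -
      have "(1::real) islimpt {0<..}" by (intro interior_limit_point) (auto simp: interior_open)
      then have "complex_of_real 1 islimpt complex_of_real ` {0<..}"
        by (intro islimpt_isCont_image) (auto simp: eventually_at_filter)
      then show ?thesis by simp
    qed
    show "(LINT t:{0<..}|lborel. ?f y t) - Gamma w * y powr (- w) = 0"
      if "y \<in> complex_of_real ` {0<..}" for y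
      using that Laplace_powr_real[OF w] by auto
  qed (use x in \<open>auto simp: open_halfspace_Re_gt convex_connected convex_halfspace_Re_gt\<close>)
  then show ?thesis by simp
qed

section \<open>Divergence of the integral of 1/t at both ends\<close>

lemma ln_diff_le_set_integral:
  assumes I: "set_integrable lborel S (\<lambda>t::real. 1 / t)" and ab: "0 < a" "a \<le> b"
    and S: "{a..b} \<subseteq> S" "S \<subseteq> {0<..}"
  shows "ln b - ln a \<le> (LINT t:S|lborel. 1 / t)"
proof -
  have "((\<lambda>t. 1 / t) has_integral (ln b - ln a)) {a..b}"
    using ab by (intro fundamental_theorem_of_calculus)
      (auto intro!: derivative_eq_intros simp flip: has_real_derivative_iff_has_vector_derivative)
  then have "ln b - ln a = integral {a..b} (\<lambda>t. 1 / t)" by (simp add: has_integral_iff)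
  also have "\<dots> = (LINT t:{a..b}|lborel. 1 / t)"
    using set_borel_integral_eq_integral(2)[OF set_integrable_subset[OF I _ S(1)]] by simp
  also have "\<dots> \<le> (LINT t:S|lborel. 1 / t)"
    unfolding set_lebesgue_integral_def
    using I set_integrable_subset[OF I _ S(1)] S unfolding set_integrable_def
    by (intro integral_mono) (auto simp: indicator_def)
  finally show ?thesis .
qed

lemma not_set_integrable_inverse_at_top:
  assumes "T > 0"
  shows "\<not> set_integrable lborel {T..} (\<lambda>t::real. 1 / t)"
proof
  assume I: "set_integrable lborel {T..} (\<lambda>t. 1 / t)"
  let ?I = "LINT t:{T..}|lborel. 1 / t" and ?b = "\<lambda>y. T * exp \<bar>y\<bar>"
  \<comment> \<open>The left side is the absolute value of \<open>?I + 1\<close>, which exceeds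
    \<open>?I\<close>; the absolute value in \<open>?b\<close> keeps the right endpoint at or above
    \<open>T\<close>.\<close>
  have "ln (?b (?I + 1)) - ln T \<le> ?I"
    using assms by (intro ln_diff_le_set_integral I) auto
  then show False using assms by (simp add: ln_mult)
qed

lemma not_set_integrable_inverse_at_0:
  "\<not> set_integrable lborel {0<..1} (\<lambda>t::real. 1 / t)"
proof
  assume I: "set_integrable lborel {0<..1} (\<lambda>t::real. 1 / t)"
  let ?I = "LINT t:{0<..1}|lborel. (1 / t :: real)"
  have "ln 1 - ln (exp (- \<bar>?I + 1\<bar>)) \<le> ?I"
    by (intro ln_diff_le_set_integral I) (auto intro: less_le_trans[OF exp_gt_zero])
  then show False by simp
qed

section \<open>The Mellin transform of the kernel\<close>

text \<open>The integrand of \<open>Z\<^sub>N(w; s)\<close> after substituting \<open>u = exp t\<close>, with \<open>x = s - r\<close>.\<close>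
definition Gm_kernel :: "nat \<Rightarrow> complex \<Rightarrow> complex \<Rightarrow> real \<Rightarrow> complex" where
  "Gm_kernel r x w t = of_real ((1 - exp (- t)) ^ r) * (exp (- x * of_real t) * of_real t powr (w - 1))"

lemma norm_Gm_kernel:
  assumes "t > 0"
  shows "norm (Gm_kernel r x w t) = (1 - exp (- t)) ^ r * (exp (- (Re x * t)) * t powr (Re w - 1))"
  using assms by (simp add: Gm_kernel_def norm_mult norm_powr_real_powr norm_power del: of_real_power of_real_diff)

lemma continuous_on_Gm_kernel: "continuous_on {0<..} (Gm_kernel r x w)"
  unfolding Gm_kernel_def by (intro continuous_intros) auto

text \<open>The bound by 1 serves for large \<open>t\<close>. The bound by
  \<open>t powr real r\<close> records the zero of order \<open>r\<close> at 0, which widens the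
  range of convergence from \<open>Re w > 0\<close> to \<open>Re w > - real r\<close>.\<close>

lemma one_minus_exp_power_bounds:
  fixes t :: real
  assumes "t > 0"
  shows "0 \<le> (1 - exp (- t)) ^ r" "(1 - exp (- t)) ^ r \<le> 1" "(1 - exp (- t)) ^ r \<le> t powr real r"
proof -
  have *: "0 \<le> 1 - exp (- t)" "1 - exp (- t) \<le> 1" "1 - exp (- t) \<le> t"
    using assms exp_ge_add_one_self[of "- t"] by auto
  show "0 \<le> (1 - exp (- t)) ^ r" "(1 - exp (- t)) ^ r \<le> 1"
    using * by (auto intro: power_le_one)
  show "(1 - exp (- t)) ^ r \<le> t powr real r"
    using power_mono[OF *(3,1), of r] assms by (simp add: powr_realpow)
qed

lemma norm_Gm_kernel_le:
  assumes "t > 0"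
  shows "norm (Gm_kernel r x w t) \<le> t powr (real r + Re w - 1) * exp (- (Re x * t))"
proof -
  have "norm (Gm_kernel r x w t) \<le> t powr real r * (exp (- (Re x * t)) * t powr (Re w - 1))"
    unfolding norm_Gm_kernel[OF assms]
    using one_minus_exp_power_bounds[OF assms] by (intro mult_right_mono) auto
  also have "\<dots> = t powr (real r + Re w - 1) * exp (- (Re x * t))"
    using assms by (simp add: algebra_simps flip: powr_add)
  finally show ?thesis .
qed

lemma Gm_kernel_integrable:
  assumes "Re x > 0" "Re w > - real r"
  shows "set_integrable lborel {0<..} (Gm_kernel r x w)"
  using norm_Gm_kernel_le continuous_on_Gm_kernel
  by (intro set_integrable_continuous_bound[OF _ set_integrable_powr_exp[of "real r + Re w" "Re x"]])
    (use assms in auto)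

lemma set_integrable_powr_at_top:
  fixes c T :: real
  assumes "c < -1" "T > 0"
  shows "set_integrable lborel {T..} (\<lambda>t. t powr c)"
proof -
  have "(\<lambda>t. t powr c) integrable_on {T..}"
    using has_integral_powr_to_inf[OF assms] by blast
  then have "(\<lambda>t. t powr c) absolutely_integrable_on {T..}"
    by (rule nonnegative_absolutely_integrable_1) auto
  moreover have "(\<lambda>t. indicator {T..} t *\<^sub>R t powr c) \<in> borel_measurable lborel"
    by measurable
  ultimately show ?thesis
    unfolding set_integrable_def by (subst (asm) integrable_completion) auto
qed

text \<open>Without exponential decay only \<open>t powr (Re w - 1)\<close> is left at infinity,
  whence the upper bound on \<open>Re w\<close>; the lower bound comes from the behaviour at
  0.\<close>

lemma Gm_kernel_integrable_boundary:
  assumes x: "Re x = 0" and w: "- real r < Re w" "Re w < 0"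
  shows "set_integrable lborel {0<..} (Gm_kernel r x w)"
proof -
  \<comment> \<open>The inserted factor \<open>exp (1 - t)\<close> is at least 1 on this interval
    and makes the Gamma majorant applicable.\<close>
  have "set_integrable lborel {0<..1} (\<lambda>t. exp 1 * (t powr (real r + Re w - 1) * exp (- (1 * t))))"
    using w by (intro set_integrable_mult_right set_integrable_subset[OF set_integrable_powr_exp]) auto
  then have "set_integrable lborel {0<..1} (Gm_kernel r x w)"
  proof (rule set_integrable_continuous_bound[rotated])
    fix t :: real assume t: "t \<in> {0<..1}"
    have "norm (Gm_kernel r x w t) \<le> t powr (real r + Re w - 1)"
      using norm_Gm_kernel_le[of t r x w] t x by simp
    also have "\<dots> \<le> t powr (real r + Re w - 1) * exp (1 - t)"
      using t mult_left_mono[of 1 "exp (1 - t)" "t powr (real r + Re w - 1)"] by simp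
    finally show "norm (Gm_kernel r x w t) \<le> exp 1 * (t powr (real r + Re w - 1) * exp (- (1 * t)))"
      by (simp add: exp_diff exp_minus field_simps)
  qed (auto intro: continuous_on_subset[OF continuous_on_Gm_kernel])
  moreover have "set_integrable lborel {1..} (Gm_kernel r x w)"
  proof (rule set_integrable_continuous_bound[OF _ set_integrable_powr_at_top])
    fix t :: real assume t: "t \<in> {1..}"
    then show "norm (Gm_kernel r x w t) \<le> t powr (Re w - 1)"
      using one_minus_exp_power_bounds[of t r] x
      by (simp add: norm_Gm_kernel mult_left_le_one_le)
  qed (use w in \<open>auto intro: continuous_on_subset[OF continuous_on_Gm_kernel]\<close>)
  ultimately have "set_integrable lborel ({0<..1} \<union> {1..}) (Gm_kernel r x w)"
    by (rule set_integrable_Un) auto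
  moreover have "{0<..1} \<union> {1..} = {0::real<..}" by auto
  ultimately show ?thesis by simp
qed

lemma set_integrable_inverse_if_le:
  fixes f :: "real \<Rightarrow> complex"
  assumes f: "set_integrable lborel B f" and A: "A \<in> sets borel" "A \<subseteq> B" "A \<subseteq> {0<..}"
    and c: "c > 0" and le: "\<And>t. t \<in> A \<Longrightarrow> c / t \<le> norm (f t)"
  shows "set_integrable lborel A (\<lambda>t. 1 / t)"
proof -
  have "set_integrable lborel A (\<lambda>t. (1 / c) *\<^sub>R norm (f t))"
    using set_integrable_norm[OF set_integrable_subset[OF f _ A(2)]] A(1) by auto
  then show ?thesis
  proof (rule set_integrable_bound[OF _ _ AE_I2], goal_cases)
    case 1
    then show ?case using A by (auto simp: set_borel_measurable_def)
  next
    case (2 t)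
    then show ?case using le[of t] c A(3) by (auto simp: field_simps)
  qed
qed

text \<open>Converse to the two integrability lemmas, by comparison with 1/t at 0 and at infinity.
  It is needed because \<open>is_Z\<close> prescribes values at every point of convergence, and it
  confines \<open>zeta_dom\<close> to a closed half-plane.\<close>

lemma Gm_kernel_integrable_imp:
  assumes I: "set_integrable lborel {0<..} (Gm_kernel r x w)"
  shows "- real r < Re w" and "0 \<le> Re x" and "Re x = 0 \<Longrightarrow> Re w < 0"
proof -
  show "- real r < Re w"
  proof (rule ccontr)
    assume w: "\<not> - real r < Re w"
    have "set_integrable lborel {0<..1} (\<lambda>t::real. 1 / t)"
    \<comment> \<open>The exponential contributes at least \<open>exp (- \<bar>Re x\<bar>)\<close>
      on (0, 1], and the power of 2 comes from \<open>1 - exp (- t) \<ge> t / 2\<close>.\<close>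
    proof (rule set_integrable_inverse_if_le[OF I, of _ "exp (- \<bar>Re x\<bar>) / 2 ^ r"])
      fix t :: real assume t: "t \<in> {0<..1}"
      have "exp (- t) \<le> 1 - t / 2"
      proof -
        have "1 + t \<le> exp t" by simp
        then have "exp (- t) \<le> 1 / (1 + t)" using t by (simp add: exp_minus field_simps)
        also have "\<dots> \<le> 1 - t / 2" using t by (simp add: field_simps)
        finally show ?thesis .
      qed
      then have "(t / 2) ^ r \<le> (1 - exp (- t)) ^ r" using t by (intro power_mono) auto
      moreover have "exp (- \<bar>Re x\<bar>) \<le> exp (- (Re x * t))"
        using t mult_mono[of "Re x" "\<bar>Re x\<bar>" t 1] by auto
      ultimately have "(t / 2) ^ r * (exp (- \<bar>Re x\<bar>) * t powr (Re w - 1)) \<le> norm (Gm_kernel r x w t)"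
        using t by (subst norm_Gm_kernel) (auto intro!: mult_mono)
      moreover have "(t / 2) ^ r * (exp (- \<bar>Re x\<bar>) * t powr (Re w - 1)) =
          exp (- \<bar>Re x\<bar>) / 2 ^ r * t powr (real r + Re w - 1)"
        using t by (simp add: power_divide powr_add powr_diff powr_realpow)
      moreover have "t powr - 1 \<le> t powr (real r + Re w - 1)"
        using t w by (intro powr_mono') auto
      then have "exp (- \<bar>Re x\<bar>) / 2 ^ r * (1 / t) \<le> exp (- \<bar>Re x\<bar>) / 2 ^ r * t powr (real r + Re w - 1)"
        using t by (intro mult_left_mono) (auto simp: powr_minus field_simps)
      ultimately show "exp (- \<bar>Re x\<bar>) / 2 ^ r / t \<le> norm (Gm_kernel r x w t)" by simp
    qed auto
    then show False using not_set_integrable_inverse_at_0 by blast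
  qed
  \<comment> \<open>For \<open>t \<ge> 1\<close> the factor \<open>(1 - exp (- t)) ^ r\<close> is at
    least \<open>1 / 2 ^ r\<close>, so it suffices that the other factors dominate 1/t from some
    point on. Both remaining claims reduce to this.\<close>
  have no_tail: False
    if T: "T \<ge> 1" and le: "\<And>t. t \<ge> T \<Longrightarrow> 1 / t \<le> exp (- (Re x * t)) * t powr (Re w - 1)" for T
  proof -
    have "set_integrable lborel {T..} (\<lambda>t::real. 1 / t)"
    proof (rule set_integrable_inverse_if_le[OF I, of _ "1 / 2 ^ r"])
      fix t assume t: "t \<in> {T..}"
      have "1 \<le> t" using t T by auto
      then have "2 \<le> exp t" using exp_ge_add_one_self[of t] by linarith
      then have "1 / 2 \<le> 1 - exp (- t)" by (simp add: exp_minus field_simps)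
      then have "(1 / 2) ^ r \<le> (1 - exp (- t)) ^ r" by (intro power_mono) auto
      then have "(1 / 2) ^ r * (1 / t) \<le> (1 - exp (- t)) ^ r * (exp (- (Re x * t)) * t powr (Re w - 1))"
        using t T le[of t] by (intro mult_mono) auto
      then show "1 / 2 ^ r / t \<le> norm (Gm_kernel r x w t)"
        using t T by (simp add: norm_Gm_kernel power_divide)
    qed (use T in auto)
    then show False using not_set_integrable_inverse_at_top[of T] T by auto
  qed
  show "0 \<le> Re x"
  proof (rule ccontr)
    assume "\<not> 0 \<le> Re x"
    define a where "a = - Re x"
    then have a: "a > 0" using \<open>\<not> 0 \<le> Re x\<close> by simp
    have "filterlim (\<lambda>t. exp (a * t) * t powr Re w) at_top at_top"
      using a by real_asymp
    then have "eventually (\<lambda>t. exp (a * t) * t powr Re w \<ge> 1) at_top"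
      by (simp add: filterlim_at_top)
    then obtain T0 where T0: "\<And>t. t \<ge> T0 \<Longrightarrow> exp (a * t) * t powr Re w \<ge> 1"
      by (auto simp: eventually_at_top_linorder)
    show False
    proof (rule no_tail[of "max 1 T0"])
      fix t assume t: "t \<ge> max 1 T0"
      then show "1 / t \<le> exp (- (Re x * t)) * t powr (Re w - 1)"
        using T0[of t] by (simp add: a_def powr_diff field_simps)
    qed auto
  qed
  show "Re w < 0" if "Re x = 0"
  proof (rule ccontr)
    assume w: "\<not> Re w < 0"
    show False
    proof (rule no_tail[of 1])
      fix t :: real assume t: "t \<ge> 1"
      have "t powr - 1 \<le> t powr (Re w - 1)" using t w by (intro powr_mono) auto
      then show "1 / t \<le> exp (- (Re x * t)) * t powr (Re w - 1)"
        using t that by (simp add: powr_minus field_simps)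
    qed auto
  qed
qed

lemma Gm_kernel_integral_holomorphic:
  assumes x: "Re x > 0"
  shows "(\<lambda>w. LINT t:{0<..}|lborel. Gm_kernel r x w t) holomorphic_on {w. Re w > - real r}"
proof (rule holomorphic_on_set_integral)
  fix w assume "w \<in> {w. Re w > - real r}"
  \<comment> \<open>Half the distance from \<open>w\<close> to the line
    \<open>Re w = - real r\<close>. For \<open>v\<close> within \<open>e\<close> of \<open>w\<close>
    the exponent lies between \<open>e - 1\<close> and \<open>3 * e - 1\<close>; the two extreme
    powers dominate for \<open>t \<le> 1\<close> and \<open>t \<ge> 1\<close> respectively.\<close>
  define e where "e = (real r + Re w) / 2"
  have e: "e > 0" using \<open>w \<in> _\<close> by (simp add: e_def)
  let ?h = "\<lambda>t. t powr (e - 1) * exp (- (Re x * t)) + t powr (3 * e - 1) * exp (- (Re x * t))"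
  have "norm (Gm_kernel r x v t) \<le> ?h t" if v: "dist w v < e" and t: "t > 0" for v t
  proof -
    have "\<bar>Re w - Re v\<bar> \<le> dist w v" using abs_Re_le_cmod[of "w - v"] by (simp add: dist_norm)
    then have re: "e - 1 \<le> real r + Re v - 1" "real r + Re v - 1 \<le> 3 * e - 1"
      using v by (auto simp: e_def abs_le_iff field_simps)
    have "t powr (real r + Re v - 1) \<le> t powr (e - 1) + t powr (3 * e - 1)"
    proof (cases "t \<le> 1")
      case True
      then have "t powr (real r + Re v - 1) \<le> t powr (e - 1)" using re t by (intro powr_mono') auto
      then show ?thesis by (simp add: add_increasing2)
    next
      case False
      then have "t powr (real r + Re v - 1) \<le> t powr (3 * e - 1)" using re t by (intro powr_mono) auto
      then show ?thesis by (simp add: add_increasing)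
    qed
    then have "t powr (real r + Re v - 1) * exp (- (Re x * t)) \<le> ?h t"
      unfolding distrib_right[symmetric] by (intro mult_right_mono) auto
    then show ?thesis using norm_Gm_kernel_le[OF t, of r x v] by linarith
  qed
  moreover have "set_integrable lborel {0<..} ?h"
    using e x by (intro set_integral_add set_integrable_powr_exp) auto
  ultimately show "\<exists>e>0. \<exists>h. set_integrable lborel {0<..} h \<and>
      (\<forall>v\<in>{w. Re w > - real r} \<inter> ball w e. \<forall>t\<in>{0<..}. norm (Gm_kernel r x v t) \<le> h t)"
    using e by (intro exI[of _ e] conjI exI[of _ ?h]) auto
next
  show "(\<lambda>w. Gm_kernel r x w t) holomorphic_on {w. Re w > - real r}" if "t \<in> {0<..}" for t
    unfolding Gm_kernel_def using that by (intro holomorphic_intros) auto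
qed (auto simp: open_halfspace_Re_gt intro: continuous_on_Gm_kernel)

section \<open>Identification of the Mellin transform with \<open>zeta_neg\<close>\<close>

lemma zeta_neg_holomorphic:
  assumes "\<And>n. n \<le> r \<Longrightarrow> of_nat n + x \<noteq> 0"
  shows "(\<lambda>w. zeta_neg r w x) holomorphic_on A"
  unfolding zeta_neg_def using assms by (auto intro!: holomorphic_intros)

text \<open>The binomial expansion turns the kernel into a sum of Laplace integrands at
  \<open>of_nat n + x\<close>. These are integrable one by one only for \<open>Re w > 0\<close>; the
  larger half-plane relies on cancellation between them.\<close>

lemma Gm_kernel_integral_Re_pos:
  assumes x: "Re x > 0" and w: "Re w > 0"
  shows "(LINT t:{0<..}|lborel. Gm_kernel r x w t) = Gamma w * zeta_neg r w x"
proof -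
  have eq: "Gm_kernel r x w t = (\<Sum>n=0..r. (-1) ^ n * of_nat (r choose n) *
      (exp (- (of_nat n + x) * of_real t) * of_real t powr (w - 1)))" for t
  proof -
    have "complex_of_real ((1 - exp (- t)) ^ r) = (- exp (- of_real t) + 1) ^ r"
      by (simp add: exp_of_real[symmetric] del: exp_of_real)
    also have "\<dots> = (\<Sum>n=0..r. of_nat (r choose n) * (- exp (- of_real t)) ^ n)"
      unfolding binomial_ring by (simp only: power_one mult_1_right atLeast0AtMost)
    also have "\<dots> = (\<Sum>n=0..r. (-1) ^ n * of_nat (r choose n) * exp (- of_nat n * of_real t))"
      by (intro sum.cong refl) (simp add: power_minus[of "exp _"] exp_of_nat_mult[symmetric])
    finally have "Gm_kernel r x w t = (\<Sum>n=0..r. (-1) ^ n * of_nat (r choose n) *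
        (exp (- of_nat n * of_real t) * exp (- x * of_real t) * of_real t powr (w - 1)))"
      unfolding Gm_kernel_def by (simp only: sum_distrib_right mult.assoc)
    moreover have "exp (- of_nat n * of_real t) * exp (- x * of_real t) = exp (- (of_nat n + x) * of_real t)" for n
      by (simp only: exp_add[symmetric] minus_add_distrib distrib_right)
    ultimately show ?thesis by simp
  qed
  have int: "set_integrable lborel {0<..} (\<lambda>t. exp (- (of_nat n + x) * of_real t) * of_real t powr (w - 1))"
    for n :: nat
    using x w by (intro Laplace_powr_integrable) (auto simp: add_nonneg_pos)
  have "(LINT t:{0<..}|lborel. Gm_kernel r x w t) =
      (\<Sum>n=0..r. LINT t:{0<..}|lborel. (-1) ^ n * of_nat (r choose n) *
        (exp (- (of_nat n + x) * of_real t) * of_real t powr (w - 1)))"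
    unfolding eq set_lebesgue_integral_def scaleR_sum_right
    using set_integrable_mult_right[OF int] unfolding set_integrable_def
    by (intro Bochner_Integration.integral_sum) blast
  also have "\<dots> = (\<Sum>n=0..r. (-1) ^ n * of_nat (r choose n) * (Gamma w * (of_nat n + x) powr (- w)))"
    unfolding set_integral_mult_right using x w
    by (intro sum.cong refl arg_cong2[of _ _ _ _ "(*)"] Laplace_powr) (auto simp: add_nonneg_pos)
  finally show ?thesis by (simp add: zeta_neg_def sum_distrib_left mult_ac)
qed

text \<open>Analytic continuation in \<open>w\<close> from \<open>Re w > 0\<close>. Writing the
  identity with \<open>rGamma\<close> avoids the poles of \<open>Gamma\<close>, so that both sides
  are holomorphic on the larger half-plane, including at 0.\<close>

lemma rGamma_Gm_kernel_integral:
  assumes x: "Re x > 0" and w: "Re w > - real r"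
  shows "rGamma w * (LINT t:{0<..}|lborel. Gm_kernel r x w t) = zeta_neg r w x"
proof (rule analytic_continuation_open[of "{w. Re w > 0}" "{w. Re w > - real r}"
      "\<lambda>w. rGamma w * (LINT t:{0<..}|lborel. Gm_kernel r x w t)" "\<lambda>w. zeta_neg r w x"])
  have "of_nat n + x \<noteq> 0" for n :: nat
    using x by (metis add_nonneg_pos less_irrefl of_nat_0_le_iff complex_Re_of_nat plus_complex.sel(1) zero_complex.sel(1))
  then show "(\<lambda>w. zeta_neg r w x) holomorphic_on {w. Re w > - real r}" by (rule zeta_neg_holomorphic)
  show "rGamma z * (LINT t:{0<..}|lborel. Gm_kernel r x z t) = zeta_neg r z x" if "z \<in> {w. Re w > 0}" for z
  proof -
    have "z \<notin> \<int>\<^sub>\<le>\<^sub>0" using that by (auto elim!: nonpos_Ints_cases)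
    then show ?thesis using that x by (simp add: Gm_kernel_integral_Re_pos rGamma_inverse_Gamma Gamma_eq_zero_iff)
  qed
  show "(\<lambda>w. rGamma w * (LINT t:{0<..}|lborel. Gm_kernel r x w t)) holomorphic_on {w. Re w > - real r}"
    by (intro holomorphic_on_mult holomorphic_rGamma Gm_kernel_integral_holomorphic x)
  show "{w. 0 < Re w} \<noteq> {}" by (auto intro: exI[of _ 1])
qed (use w in \<open>auto simp: open_halfspace_Re_gt convex_connected convex_halfspace_Re_gt\<close>)

text \<open>
  On the line \<open>Re s = r\<close> the integral defining \<open>Z\<^sub>N(w; s)\<close> still converges for \<open>w\<close> in a vertical
  strip, so \<open>zeta_dom\<close> is not open and its boundary points must be treated separately.
\<close>
lemma rGamma_Gm_kernel_integral_boundary: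
  assumes x: "Re x = 0" "x \<noteq> 0" and w: "- real r < Re w" "Re w < 0"
  shows "rGamma w * (LINT t:{0<..}|lborel. Gm_kernel r x w t) = zeta_neg r w x"
proof -
  \<comment> \<open>The boundary point is approached from the right, so the norm of the kernel at
    \<open>x\<close> itself dominates the whole sequence.\<close>
  let ?y = "\<lambda>i. x + of_real (inverse (real (Suc i)))"
  have y: "?y \<longlonglongrightarrow> x"
    using tendsto_add[OF tendsto_const[of x] tendsto_of_real[OF LIMSEQ_inverse_real_of_nat]]
    by (simp only: of_real_0 add_0_right)
  have "(\<lambda>i. LINT t:{0<..}|lborel. Gm_kernel r (?y i) w t) \<longlonglongrightarrow> (LINT t:{0<..}|lborel. Gm_kernel r x w t)"
    unfolding set_lebesgue_integral_def
  proof (rule integral_dominated_convergence)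
    show "integrable lborel (\<lambda>t. indicator {0<..} t *\<^sub>R norm (Gm_kernel r x w t))"
      using set_integrable_norm[OF Gm_kernel_integrable_boundary[OF x(1) w]] by (simp add: set_integrable_def)
    show "AE t in lborel. (\<lambda>i. indicat_real {0<..} t *\<^sub>R Gm_kernel r (?y i) w t)
        \<longlonglongrightarrow> indicat_real {0<..} t *\<^sub>R Gm_kernel r x w t"
      unfolding Gm_kernel_def by (intro AE_I2 tendsto_intros y)
    show "AE t in lborel. norm (indicat_real {0<..} t *\<^sub>R Gm_kernel r (?y i) w t)
        \<le> indicator {0<..} t *\<^sub>R norm (Gm_kernel r x w t)" for i
      using x one_minus_exp_power_bounds(1)[of _ r]
      by (intro AE_I2) (auto simp: indicator_def norm_Gm_kernel intro!: mult_left_mono mult_left_le_one_le)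
    show "(\<lambda>t. indicat_real {0<..} t *\<^sub>R Gm_kernel r y w t) \<in> borel_measurable lborel" for y
      using set_borel_measurable_continuous_on[OF _ continuous_on_Gm_kernel]
      by (simp add: set_borel_measurable_def)
    then show "(\<lambda>t. indicat_real {0<..} t *\<^sub>R Gm_kernel r (?y i) w t) \<in> borel_measurable lborel" for i .
  qed
  then have "(\<lambda>i. rGamma w * (LINT t:{0<..}|lborel. Gm_kernel r (?y i) w t)) \<longlonglongrightarrow>
      rGamma w * (LINT t:{0<..}|lborel. Gm_kernel r x w t)"
    by (intro tendsto_intros)
  moreover have "rGamma w * (LINT t:{0<..}|lborel. Gm_kernel r (?y i) w t) = zeta_neg r w (?y i)" for i
    using x w by (intro rGamma_Gm_kernel_integral) auto
  moreover have "(\<lambda>i. zeta_neg r w (?y i)) \<longlonglongrightarrow> zeta_neg r w x"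
  proof -
    \<comment> \<open>A nonzero imaginary part keeps these points off the branch cut, so the powers
      are continuous there.\<close>
    have "of_nat n + x \<notin> \<real>\<^sub>\<le>\<^sub>0" for n :: nat
      using x by (auto simp: complex_nonpos_Reals_iff complex_eq_iff)
    then show ?thesis unfolding zeta_neg_def by (intro tendsto_intros y disjI1)
  qed
  ultimately show ?thesis by (simp add: LIMSEQ_unique)
qed

section \<open>Continuation in \<open>w\<close> and in \<open>s\<close>\<close>

definition Gm_count :: "nat \<Rightarrow> real \<Rightarrow> complex" where
  "Gm_count r = (\<lambda>u. of_real ((u - 1) ^ r))"

lemma zeta_Gm_eq_zeta_N: "zeta_Gm r = zeta_N (Gm_count r)"
  by (simp only: zeta_Gm_def Gm_count_def)

text \<open>The Jacobian cancels the -1 in the exponent, and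
  \<open>(exp t - 1) ^ r = exp (real r * t) * (1 - exp (- t)) ^ r\<close> shifts \<open>s\<close> to
  \<open>s - of_nat r\<close>.\<close>

lemma Z_integrand_exp:
  assumes "t > 0"
  shows "exp t *\<^sub>R Z_integrand (Gm_count r) s w (exp t) = Gm_kernel r (s - of_nat r) w t"
proof -
  have "(exp t - 1) ^ r = exp (real r * t) * (1 - exp (- t)) ^ r"
    unfolding exp_of_nat_mult power_mult_distrib[symmetric] by (simp add: exp_minus right_diff_distrib)
  then have 1: "complex_of_real ((exp t - 1) ^ r) = exp (of_nat r * of_real t) * of_real ((1 - exp (- t)) ^ r)"
    by (simp add: exp_of_real[symmetric] del: exp_of_real of_real_power of_real_diff)
  have 2: "complex_of_real (exp t) powr (- s - 1) = exp ((- s - 1) * of_real t)"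
    by (simp add: powr_def Ln_of_real)
  have 3: "of_real (exp t) * (exp (of_nat r * of_real t) * exp ((- s - 1) * of_real t)) =
      exp (- (s - of_nat r) * complex_of_real t)"
    unfolding exp_of_real[symmetric] exp_add[symmetric] by (simp add: algebra_simps)
  have "exp t *\<^sub>R Z_integrand (Gm_count r) s w (exp t) =
      of_real ((1 - exp (- t)) ^ r) * (of_real (exp t) * (exp (of_nat r * of_real t) *
        exp ((- s - 1) * of_real t)) * of_real t powr (w - 1))"
    unfolding Z_integrand_def Gm_count_def scaleR_conv_of_real 1 2 ln_exp by (simp only: mult_ac)
  then show ?thesis unfolding 3 Gm_kernel_def .
qed

lemma continuous_on_Z_integrand: "continuous_on {1<..} (Z_integrand (Gm_count r) s w)"
  unfolding Z_integrand_def Gm_count_def by (intro continuous_intros) auto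

lemma Z_integrand_integrable_iff:
  "set_integrable lborel {1<..} (Z_integrand (Gm_count r) s w) \<longleftrightarrow>
    set_integrable lborel {0<..} (Gm_kernel r (s - of_nat r) w)"
  unfolding set_integral_exp_substitution(1)[OF continuous_on_Z_integrand]
  by (intro set_integrable_cong) (auto simp: Z_integrand_exp)

lemma Z_integrand_integral:
  "(LINT u:{1<..}|lborel. Z_integrand (Gm_count r) s w u) =
    (LINT t:{0<..}|lborel. Gm_kernel r (s - of_nat r) w t)"
  unfolding set_integral_exp_substitution(2)[OF continuous_on_Z_integrand]
  by (intro set_lebesgue_integral_cong) (auto simp: Z_integrand_exp)

lemma Z_conv_Gm_imp:
  assumes "w \<in> Z_conv (Gm_count r) s"
  shows "- real r < Re w" "real r \<le> Re s" "Re s = real r \<Longrightarrow> Re w < 0"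
  using Gm_kernel_integrable_imp[of r "s - of_nat r" w] assms
  by (auto simp: Z_conv_def Z_integrand_integrable_iff)

section \<open>Uniqueness and existence of the continuation in w\<close>

lemma is_Z_unique: "is_Z N s F \<Longrightarrow> is_Z N s G \<Longrightarrow> F = G"
  unfolding is_Z_def
  by (rule nicely_meromorphic_eqI[of F G "interior (Z_conv N s)"])
    (auto dest!: subsetD[OF interior_subset])

lemma Z_fun_eqI:
  assumes "is_Z N s F"
  shows "Z_fun N w s = F w"
proof -
  have "(THE F. is_Z N s F) = F" using assms is_Z_unique by (intro the_equality)
  then show ?thesis by (simp add: Z_fun_def)
qed

text \<open>The continuation is a finite sum of entire functions of \<open>w\<close>, since no base
  \<open>of_nat n + (s - of_nat r)\<close> vanishes; in particular it has no poles.\<close>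

lemma is_Z_Gm:
  assumes r: "r \<ge> 1" and s: "Re s \<ge> real r" "s \<noteq> of_nat r"
  shows "is_Z (Gm_count r) s (\<lambda>w. zeta_neg r w (s - of_nat r))"
    and "(\<lambda>w. zeta_neg r w (s - of_nat r)) holomorphic_on UNIV"
proof -
  have "of_nat n + (s - of_nat r) \<noteq> 0" for n
  proof
    assume "of_nat n + (s - of_nat r) = 0"
    then have eq: "s = of_nat r - of_nat n" by (simp add: algebra_simps eq_diff_eq)
    then have "n = 0" using s(1) by simp
    then show False using eq s(2) by simp
  qed
  then show hol: "(\<lambda>w. zeta_neg r w (s - of_nat r)) holomorphic_on UNIV"
    by (intro zeta_neg_holomorphic)
  show "is_Z (Gm_count r) s (\<lambda>w. zeta_neg r w (s - of_nat r))"
    unfolding is_Z_def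
  proof (intro conjI ballI)
    show "(\<lambda>w. zeta_neg r w (s - of_nat r)) nicely_meromorphic_on UNIV"
      using hol by (intro analytic_on_imp_nicely_meromorphic_on) (simp add: analytic_on_open)
    \<comment> \<open>This strip lies in the region of convergence both for
      \<open>Re s > real r\<close> and on the boundary line.\<close>
    have "{w. - real r < Re w} \<inter> {w. Re w < 0} \<subseteq> Z_conv (Gm_count r) s"
      unfolding Z_conv_def Z_integrand_integrable_iff
      using s Gm_kernel_integrable[of "s - of_nat r" r] Gm_kernel_integrable_boundary[of "s - of_nat r" r]
      by (cases "Re s = real r") auto
    moreover have "open ({w. - real r < Re w} \<inter> {w. Re w < 0})"
      by (intro open_Int) (auto simp: open_halfspace_Re_gt open_halfspace_Re_lt)
    ultimately have "{w. - real r < Re w} \<inter> {w. Re w < 0} \<subseteq> interior (Z_conv (Gm_count r) s)"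
      by (rule interior_maximal)
    moreover have "complex_of_real (- 1 / 2) \<in> {w. - real r < Re w} \<inter> {w. Re w < 0}"
      using r by (simp del: of_real_divide)
    ultimately show "interior (Z_conv (Gm_count r) s) \<noteq> {}" by blast
    fix w assume w: "w \<in> Z_conv (Gm_count r) s"
    show "zeta_neg r w (s - of_nat r) = rGamma w * (LINT u:{1<..}|lborel. Z_integrand (Gm_count r) s w u)"
      unfolding Z_integrand_integral using Z_conv_Gm_imp[OF w] s
        rGamma_Gm_kernel_integral[of "s - of_nat r" r w] rGamma_Gm_kernel_integral_boundary[of "s - of_nat r" r w]
      by (cases "Re s = real r") auto
  qed
qed

lemma zeta_dom_Gm_superset:
  assumes "r \<ge> 1" "Re s \<ge> real r" "s \<noteq> of_nat r"
  shows "s \<in> zeta_dom (Gm_count r)"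
proof -
  have "(\<lambda>w. zeta_neg r w (s - of_nat r)) analytic_on {0}"
    using is_Z_Gm(2)[OF assms] by (intro holomorphic_on_imp_analytic_at[of _ UNIV]) auto
  then show ?thesis using is_Z_Gm(1)[OF assms] by (auto simp: zeta_dom_def)
qed

lemma zeta_dom_Gm_subset: "zeta_dom (Gm_count r) \<subseteq> {s. Re s \<ge> real r}"
proof
  fix s assume "s \<in> zeta_dom (Gm_count r)"
  then obtain w where "w \<in> Z_conv (Gm_count r) s"
    using interior_subset unfolding zeta_dom_def is_Z_def by blast
  then show "s \<in> {s. Re s \<ge> real r}" using Z_conv_Gm_imp(2) by blast
qed

text \<open>The two inclusions leave open whether \<open>s = of_nat r\<close> belongs to
  \<open>zeta_dom\<close>, but the interior does not depend on it.\<close>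

lemma interior_zeta_dom_Gm:
  assumes "r \<ge> 1"
  shows "interior (zeta_dom (Gm_count r)) = {s. Re s > real r}"
proof
  have "interior {s. Re s \<ge> real r} = {s. Re s > real r}"
    using interior_halfspace_ge[of "1::complex" "real r"] by simp
  then show "interior (zeta_dom (Gm_count r)) \<subseteq> {s. Re s > real r}"
    using interior_mono[OF zeta_dom_Gm_subset] by blast
  show "{s. Re s > real r} \<subseteq> interior (zeta_dom (Gm_count r))"
  proof (rule interior_maximal)
    show "{s. Re s > real r} \<subseteq> zeta_dom (Gm_count r)"
    proof
      fix s assume "s \<in> {s. Re s > real r}"
      then have "Re s \<ge> real r" "s \<noteq> of_nat r" by auto
      then show "s \<in> zeta_dom (Gm_count r)" by (rule zeta_dom_Gm_superset[OF assms])
    qed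
  qed (simp add: open_halfspace_Re_gt)
qed

lemma zeta_direct_Gm:
  assumes "r \<ge> 1" "Re s \<ge> real r" "s \<noteq> of_nat r"
  shows "zeta_direct (Gm_count r) s = Gamma_neg r (s - of_nat r)"
  unfolding zeta_direct_def Gamma_neg_def Z_fun_eqI[OF is_Z_Gm(1)[OF assms]] ..

text \<open>
  The rational function of \<open>x\<close> that \<open>Gamma_neg\<close> agrees with off \<open>{0, -1, \<dots>, -r}\<close>; at those points
  \<open>Gamma_neg\<close> itself takes junk values, because \<open>0 powr w = 0\<close>.
\<close>
definition Gamma_neg_rat :: "nat \<Rightarrow> complex \<Rightarrow> complex" where
  "Gamma_neg_rat r x = (\<Prod>n=0..r. (of_nat n + x) powi (- ((-1) ^ n * int (r choose n))))"

text \<open>Differentiating at \<open>w = 0\<close> gives an integer combination of logarithms.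
  Exponentiating it removes the choice of branch, which is why the result is rational in
  \<open>x\<close>.\<close>

lemma Gamma_neg_eq_rat:
  assumes x: "\<And>n. n \<le> r \<Longrightarrow> of_nat n + x \<noteq> 0"
  shows "Gamma_neg r x = Gamma_neg_rat r x"
proof -
  have "((\<lambda>w. (of_nat n + x) powr (- w)) has_field_derivative - Ln (of_nat n + x)) (at 0)"
    if "n \<in> {0..r}" for n
    using x[of n] that unfolding powr_def by (auto intro!: derivative_eq_intros)
  note DERIV_cmult[OF this]
  then have "((\<lambda>w. zeta_neg r w x) has_field_derivative
      (\<Sum>n=0..r. of_int (- ((-1) ^ n * int (r choose n))) * Ln (of_nat n + x))) (at 0)"
    unfolding zeta_neg_def by (intro DERIV_sum) (fastforce simp del: of_nat_Suc)
  then have "Gamma_neg r x = exp (\<Sum>n=0..r. of_int (- ((-1) ^ n * int (r choose n))) * Ln (of_nat n + x))"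
    unfolding Gamma_neg_def by (simp only: DERIV_imp_deriv)
  also have "\<dots> = (\<Prod>n=0..r. exp (of_int (- ((-1) ^ n * int (r choose n))) * Ln (of_nat n + x)))"
    by (rule exp_sum) simp
  also have "\<dots> = Gamma_neg_rat r x"
    unfolding Gamma_neg_rat_def
  proof (intro prod.cong refl)
    fix n assume "n \<in> {0..r}"
    then have "exp (Ln (of_nat n + x)) = of_nat n + x" using x by simp
    then show "exp (of_int (- ((-1) ^ n * int (r choose n))) * Ln (of_nat n + x)) =
        (of_nat n + x) powi (- ((-1) ^ n * int (r choose n)))"
      by (metis exp_power_int mult.commute)
  qed
  finally show ?thesis .
qed

lemma Gamma_neg_rat_analytic:
  assumes "\<And>n. n \<le> r \<Longrightarrow> of_nat n + x \<noteq> 0"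
  shows "(\<lambda>s. Gamma_neg_rat r (s - c)) analytic_on {x + c}"
  unfolding Gamma_neg_rat_def using assms by (intro analytic_intros) auto

lemma shift_nonzero:
  fixes s :: complex
  assumes "s \<notin> of_nat ` {0..r}" "n \<le> r"
  shows "of_nat n + (s - of_nat r) \<noteq> 0"
proof
  assume "of_nat n + (s - of_nat r) = 0"
  then have "s = of_nat (r - n)" using assms(2) by (simp add: of_nat_diff algebra_simps eq_diff_eq)
  moreover have "r - n \<in> {0..r}" by simp
  ultimately show False using assms(1) by blast
qed

text \<open>\<open>remove_sings\<close> supplies the normalised values that
  \<open>nicely_meromorphic_on\<close> demands without an inspection of zeros and poles, and changes
  nothing where the rational function is analytic.\<close>

lemma is_zeta_continuation_Gm:
  assumes "r \<ge> 1"
  shows "is_zeta_continuation (Gm_count r) (remove_sings (\<lambda>s. Gamma_neg_rat r (s - of_nat r)))"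
    (is "is_zeta_continuation _ ?G")
  unfolding is_zeta_continuation_def interior_zeta_dom_Gm[OF assms]
proof (intro conjI ballI)
  show "?G nicely_meromorphic_on UNIV"
    unfolding Gamma_neg_rat_def
    by (intro remove_sings_nicely_meromorphic meromorphic_intros)
  show "{s. real r < Re s} \<noteq> {}" by (auto intro: exI[of _ "of_nat (r + 1)"])
  fix s assume "s \<in> {s. real r < Re s}"
  then have s: "Re s > real r" by simp
  then have "s \<notin> of_nat ` {0..r}" by auto
  note nz = shift_nonzero[OF this]
  have "?G s = Gamma_neg_rat r (s - of_nat r)"
    using Gamma_neg_rat_analytic[OF nz, of r "of_nat r"] by simp
  also have "\<dots> = zeta_direct (Gm_count r) s"
    using s assms nz by (subst zeta_direct_Gm) (auto simp: Gamma_neg_eq_rat)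
  finally show "?G s = zeta_direct (Gm_count r) s" .
qed

lemma is_zeta_continuation_unique:
  "is_zeta_continuation N F \<Longrightarrow> is_zeta_continuation N G \<Longrightarrow> F = G"
  unfolding is_zeta_continuation_def
  by (rule nicely_meromorphic_eqI[of F G "interior (zeta_dom N)"]) auto

text \<open>The excluded \<open>s\<close> are those for which some
  \<open>of_nat n + (s - of_nat r)\<close> with \<open>n \<le> r\<close> vanishes. The cases follow
  the definition of \<open>zeta_N\<close>: the direct formula on \<open>zeta_dom\<close>, the
  continuation in \<open>s\<close> elsewhere.\<close>

lemma zeta_Gm_eq_Gamma_neg:
  assumes r: "r \<ge> 1" and s: "s \<notin> of_nat ` {0..r}"
  shows "zeta_Gm r s = Gamma_neg r (s - of_nat r)"
proof (cases "s \<in> zeta_dom (Gm_count r)")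
  case True
  then have "Re s \<ge> real r" "s \<noteq> of_nat r" using zeta_dom_Gm_subset s by auto
  then show ?thesis using True r by (simp add: zeta_Gm_eq_zeta_N zeta_N_def zeta_direct_Gm)
next
  case False
  note nz = shift_nonzero[OF s]
  have "(THE G. is_zeta_continuation (Gm_count r) G) = remove_sings (\<lambda>s. Gamma_neg_rat r (s - of_nat r))"
    using is_zeta_continuation_Gm[OF r] is_zeta_continuation_unique by (intro the_equality)
  then show ?thesis
    using False Gamma_neg_rat_analytic[OF nz, of r "of_nat r"] nz
    by (simp add: zeta_Gm_eq_zeta_N zeta_N_def Gamma_neg_eq_rat)
qed

lemma zeta_Gm_eq_exp_integral:
  assumes r: "r \<ge> 1" and s: "Re s > real r"
  shows "zeta_Gm r s = exp (LINT u:{1<..}|lborel. Z_integrand (Gm_count r) s 0 u)"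
proof -
  let ?x = "s - of_nat r" and ?S = "{w. Re w > - real r}"
  let ?I = "\<lambda>w. LINT t:{0<..}|lborel. Gm_kernel r ?x w t"
  have x: "Re ?x > 0" using s by simp
  have S: "open ?S" "0 \<in> ?S" using r by (auto simp: open_halfspace_Re_gt)
  have "(?I has_field_derivative deriv ?I 0) (at 0)"
    using Gm_kernel_integral_holomorphic[OF x] S by (rule holomorphic_derivI)
  moreover have "(rGamma has_field_derivative 1) (at (0::complex))"
    using has_field_derivative_rGamma_nonpos_int[of 0] by simp
  \<comment> \<open>In the product rule the term with the derivative of \<open>?I\<close> drops out
    because \<open>rGamma 0 = 0\<close>.\<close>
  ultimately have "((\<lambda>w. rGamma w * ?I w) has_field_derivative ?I 0) (at 0)"
    by (auto intro!: derivative_eq_intros)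
  then have "((\<lambda>w. zeta_neg r w ?x) has_field_derivative ?I 0) (at 0)"
    by (rule has_field_derivative_transform_within_open[OF _ S])
      (use rGamma_Gm_kernel_integral[OF x] in auto)
  then have "Gamma_neg r ?x = exp (?I 0)" by (simp add: Gamma_neg_def DERIV_imp_deriv)
  moreover have "s \<notin> of_nat ` {0..r}" using s by auto
  ultimately show ?thesis using r by (simp add: zeta_Gm_eq_Gamma_neg Z_integrand_integral)
qed

theorem theorem3:
  fixes r :: nat
  assumes "r \<ge> 1"
  shows "(\<forall>s::complex. s \<notin> of_nat ` {0..r} \<longrightarrow> zeta_Gm r s = Gamma_neg r (s - of_nat r)) \<and>
         (\<forall>s::complex. Re s > real r \<longrightarrow>
            set_integrable lborel {1<..}
              (\<lambda>u::real. of_real ((u - 1) ^ r) * of_real u powr (- s - 1) * inverse (of_real (ln u))) \<and>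
            zeta_Gm r s =
              exp (LINT u:{1<..}|lborel.
                     of_real ((u - 1) ^ r) * of_real u powr (- s - 1) * inverse (of_real (ln u))))"
proof (intro conjI allI impI)
  fix s :: complex
  show "zeta_Gm r s = Gamma_neg r (s - of_nat r)" if "s \<notin> of_nat ` {0..r}"
    using zeta_Gm_eq_Gamma_neg[OF assms that] .
  assume s: "Re s > real r"
  have eq: "of_real ((u - 1) ^ r) * of_real u powr (- s - 1) * inverse (of_real (ln u)) =
      Z_integrand (Gm_count r) s 0 u" if "u \<in> {1<..}" for u
    using that by (simp add: Z_integrand_def Gm_count_def powr_minus)
  have "set_integrable lborel {1<..} (Z_integrand (Gm_count r) s 0)"
    unfolding Z_integrand_integrable_iff using s assms by (intro Gm_kernel_integrable) auto
  then show "set_integrable lborel {1<..}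
      (\<lambda>u. of_real ((u - 1) ^ r) * of_real u powr (- s - 1) * inverse (of_real (ln u)))"
    by (subst set_integrable_cong[OF refl refl eq])
  have "(LINT u:{1<..}|lborel. of_real ((u - 1) ^ r) * of_real u powr (- s - 1) * inverse (of_real (ln u))) =
      (LINT u:{1<..}|lborel. Z_integrand (Gm_count r) s 0 u)"
    using eq by (intro set_lebesgue_integral_cong) auto
  then show "zeta_Gm r s = exp (LINT u:{1<..}|lborel.
      of_real ((u - 1) ^ r) * of_real u powr (- s - 1) * inverse (of_real (ln u)))"
    using zeta_Gm_eq_exp_integral[OF assms s] by simp
qed

end
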